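(* Let $n,d,m_1,\dots,m_n$ be positive integers with $M=m_1+\dots+m_n$ satisfying $d-1<M\le 2d-2$ and $1\le m_j\le d-1$ for $j=1,\dots,n$. Let $z_1,\dots,z_n$ be fixed pairwise distinct complex numbers, $W(x)=(x-z_1)^{m_1}\cdots(x-z_n)^{m_n}$, $k=M+1-d$, and let $$\Phi(\mathbf t)=\frac{\prod_{1\le j<l\le k}(t_j-t_l)^2}{\prod_{i=1}^kW(t_i)}$$ be the master function, defined for $\mathbf t=(t_1,\dots,t_k)$ in $$T=\{\mathbf t\in\mathbb C^k \mid t_i\ne t_l \text{ for } i\neq l,\ t_i\ne z_j,\ 1\le i,l\le k,\ 1\le j\le n\}.$$ There is a one-to-one correspondence between the orbits of critical points of the master function $\Phi(\mathbf t)$ (under the symmetric group permuting $t_1,\dots,t_k$) and the nondegenerate planes of degree $d$ with the Wronskian $W(x)$.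
   Context: A plane is a two-dimensional linear subspace $V$ of the vector space of complex polynomials in one variable $x$. The degree of $V$ is the maximal degree of polynomials in $V$; the order of $V$ is the minimal degree of non-zero polynomials in $V$. A plane $V$ is generic if for every $z\in\mathbb C$ there is $p(x)\in V$ with $p(z)\ne0$. A generic plane $V$ of order $r>0$ is nondegenerate if the polynomials of degree $r$ in $V$ do not have multiple roots. The Wronskian of polynomials $g,f$ is $W[g,f]=g'f-gf'$; the Wronskian of $V$ is the monic polynomial proportional to the Wronskian of some (hence any) basis of $V$. A critical point of $\Phi$ is a point $\mathbf t^0\in T$ with $\frac{\partial\Phi}{\partial t_i}(\mathbf t^0)=0$ for $i=1,\dots,k$. The symmetric group acts on $T$ by permuting the coordinates and preserves the set of critical points. *)

theory Defs
  imports
    Complex_Main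
    "HOL-Library.FuncSet"
    "HOL-Computational_Algebra.Polynomial"
    "HOL-Combinatorics.Permutations"
begin

definition is_plane :: "complex poly set \<Rightarrow> bool" where
  "is_plane V \<longleftrightarrow> module.subspace smult V \<and> vector_space.dim smult V = 2"

text \<open>
  On a plane the set of degrees is finite and nonempty, so \<open>Max\<close> and \<open>Min\<close> are proper.
  The zero polynomial counts as having degree 0, which does not affect the maximum.
\<close>

definition plane_degree :: "complex poly set \<Rightarrow> nat" where
  "plane_degree V = Max (degree ` V)"

definition plane_order :: "complex poly set \<Rightarrow> nat" where
  "plane_order V = Min (degree ` (V - {0}))"

definition generic_plane :: "complex poly set \<Rightarrow> bool" where
  "generic_plane V \<longleftrightarrow> is_plane V \<and> (\<forall>z. \<exists>p\<in>V. poly p z \<noteq> 0)"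

text \<open>\<open>rsquarefree p\<close> says that \<open>p\<close> is nonzero and has no multiple roots.\<close>

definition nondegenerate_plane :: "complex poly set \<Rightarrow> bool" where
  "nondegenerate_plane V \<longleftrightarrow>
     generic_plane V \<and> plane_order V > 0 \<and>
     (\<forall>p\<in>V. degree p = plane_order V \<longrightarrow> rsquarefree p)"

definition wronskian :: "complex poly \<Rightarrow> complex poly \<Rightarrow> complex poly" where
  "wronskian g f = pderiv g * f - g * pderiv f"

definition plane_basis :: "complex poly set \<Rightarrow> complex poly \<Rightarrow> complex poly \<Rightarrow> bool" where
  "plane_basis V g f \<longleftrightarrow>
     g \<noteq> f \<and> \<not> module.dependent smult {g, f} \<and> module.span smult {g, f} = V"

definition plane_wronskian :: "complex poly set \<Rightarrow> complex poly" where
  "plane_wronskian V =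
     (THE w. lead_coeff w = 1 \<and>
             (\<exists>g f c. plane_basis V g f \<and> w = smult c (wronskian g f)))"

text \<open>
  A point of \<open>\<complex>\<^sup>k\<close> is a function on \<open>{1..k}\<close>, extended by \<open>undefined\<close> outside, so that
  distinct functions are distinct points.
\<close>

definition config_space :: "nat \<Rightarrow> nat \<Rightarrow> (nat \<Rightarrow> complex) \<Rightarrow> (nat \<Rightarrow> complex) set" where
  "config_space k n z =
     {t \<in> {1..k} \<rightarrow>\<^sub>E UNIV.
        (\<forall>i\<in>{1..k}. \<forall>l\<in>{1..k}. i \<noteq> l \<longrightarrow> t i \<noteq> t l) \<and>
        (\<forall>i\<in>{1..k}. \<forall>j\<in>{1..n}. t i \<noteq> z j)}"

definition master_function :: "nat \<Rightarrow> complex poly \<Rightarrow> (nat \<Rightarrow> complex) \<Rightarrow> complex" where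
  "master_function k W t =
     (\<Prod>l\<in>{1..k}. \<Prod>j\<in>{1..<l}. (t j - t l)\<^sup>2) / (\<Prod>i\<in>{1..k}. poly W (t i))"

definition critical_points ::
    "nat \<Rightarrow> nat \<Rightarrow> (nat \<Rightarrow> complex) \<Rightarrow> complex poly \<Rightarrow> (nat \<Rightarrow> complex) set" where
  "critical_points k n z W =
     {t \<in> config_space k n z.
        \<forall>i\<in>{1..k}. ((\<lambda>w. master_function k W (t(i := w))) has_field_derivative 0) (at (t i))}"

definition perm_orbit :: "nat \<Rightarrow> (nat \<Rightarrow> complex) \<Rightarrow> (nat \<Rightarrow> complex) set" where
  "perm_orbit k t = {t \<circ> \<sigma> |\<sigma>. \<sigma> permutes {1..k}}"

end

theory Submission
  imports Defs "HOL-Computational_Algebra.Fundamental_Theorem_Algebra"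
begin

text \<open>
  A critical point \<open>t\<close> is encoded by \<open>f = (x - t\<^sub>1)\<cdots>(x - t\<^sub>k)\<close>; the critical point equations say
  that \<open>W f'' - W' f'\<close> vanishes at the roots of \<open>f\<close>, that is, that \<open>W / f\<^sup>2\<close> has no residues.
  This is exactly the condition for an antiderivative of \<open>W / f\<^sup>2\<close> to be of the form \<open>g / f\<close>
  with a polynomial \<open>g\<close>, i.e. for \<open>g' f - g f' = W\<close> to be solvable, and the plane
  of \<open>t\<close> is spanned by \<open>f\<close> and \<open>g\<close>. Conversely, a nondegenerate plane contains a unique monic
  polynomial \<open>f\<close> of minimal degree. The degree of the Wronskian of polynomials of distinct degrees
  \<open>r\<close> and \<open>d\<close> is \<open>d + r - 1\<close>, so \<open>f\<close> has degree \<open>k\<close>.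
\<close>

section \<open>Wronskians\<close>

text \<open>The Wronskian is bilinear and alternating, so a change of basis multiplies it by the
  determinant. Up to a scalar it therefore depends on the plane only.\<close>

lemma wronskian_lincomb:
  "wronskian (smult a g + smult b f) (smult c g + smult e f) = smult (a * e - b * c) (wronskian g f)"
  by (rule poly_eqI)
    (simp add: wronskian_def pderiv_add pderiv_smult algebra_simps)

lemma wronskian_diff_smult: "wronskian (p - smult c g) f = wronskian p f - smult c (wronskian g f)"
  by (simp add: wronskian_def pderiv_diff pderiv_smult algebra_simps smult_diff_right)

lemma wronskian_commute: "wronskian f g = - wronskian g f"
  by (simp add: wronskian_def algebra_simps)

lemma wronskian_self [simp]: "wronskian f f = 0"
  by (simp add: wronskian_def)

lemma pderiv_wronskian:
  "pderiv (wronskian g f) = pderiv (pderiv g) * f - g * pderiv (pderiv f)"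
  by (simp add: wronskian_def pderiv_diff pderiv_mult algebra_simps)

lemma degree_wronskian_le: "degree (wronskian g f) \<le> degree g + degree f - 1"
proof (cases "degree g = 0 \<or> degree f = 0")
  \<comment> \<open>Constants are treated apart: truncated subtraction gives their derivative degree
    0 instead of -1, so the product bound of the other case can exceed the claim by 1.\<close>
  case True
  then show ?thesis
  proof
    assume "degree g = 0"
    then obtain a where "g = [:a:]" by (meson degree_eq_zeroE)
    then show ?thesis by (simp add: wronskian_def degree_pderiv order.trans[OF degree_smult_le])
  next
    assume "degree f = 0"
    then obtain a where "f = [:a:]" by (meson degree_eq_zeroE)
    then show ?thesis by (simp add: wronskian_def degree_pderiv order.trans[OF degree_smult_le])
  qed
next
  case False
  have "degree (pderiv g * f) \<le> degree g + degree f - 1"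
    using degree_mult_le[of "pderiv g" f] False by (simp add: degree_pderiv)
  moreover have "degree (g * pderiv f) \<le> degree g + degree f - 1"
    using degree_mult_le[of g "pderiv f"] False by (simp add: degree_pderiv)
  ultimately show ?thesis
    unfolding wronskian_def by (rule degree_diff_le)
qed

text \<open>The two products contribute \<open>degree g\<close> and \<open>degree f\<close> times
  the product of the leading coefficients. Distinct degrees thus keep the top terms from
  cancelling.\<close>

lemma coeff_wronskian:
  assumes "degree f < degree g"
  shows "coeff (wronskian g f) (degree g + degree f - 1)
       = of_nat (degree g - degree f) * lead_coeff g * lead_coeff f"
proof -
  have 1: "coeff (pderiv g * f) (degree g + degree f - 1) = of_nat (degree g) * lead_coeff g * lead_coeff f"
    using coeff_mult_degree_sum[of "pderiv g" f] assms
    by (cases "degree g") (auto simp: degree_pderiv coeff_pderiv)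
  have 2: "coeff (g * pderiv f) (degree g + degree f - 1) = of_nat (degree f) * lead_coeff g * lead_coeff f"
  proof (cases "degree f")
    case 0
    then obtain a where "f = [:a:]" by (meson degree_eq_zeroE)
    then show ?thesis by simp
  next
    case (Suc r)
    then show ?thesis using coeff_mult_degree_sum[of g "pderiv f"]
      by (auto simp: degree_pderiv coeff_pderiv)
  qed
  show ?thesis
    unfolding wronskian_def coeff_diff 1 2 using assms by (simp add: of_nat_diff algebra_simps)
qed

lemma
  assumes "degree f < degree g" and "f \<noteq> 0"
  shows wronskian_nonzero: "wronskian g f \<noteq> 0"
    and degree_wronskian: "degree (wronskian g f) = degree g + degree f - 1"
proof -
  have nz: "coeff (wronskian g f) (degree g + degree f - 1) \<noteq> 0"
    using coeff_wronskian[OF assms(1)] assms by auto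
  then show "wronskian g f \<noteq> 0" by auto
  show "degree (wronskian g f) = degree g + degree f - 1"
    using degree_wronskian_le[of g f] le_degree[OF nz] by linarith
qed

text \<open>The last hypothesis excludes a zero difference, whose conventional degree 0 would not be
  smaller than that of a constant \<open>f\<close>.\<close>

lemma degree_cancel_less:
  fixes g f :: "complex poly"
  assumes "degree g = degree f" and "f \<noteq> 0" and "g \<noteq> smult (lead_coeff g / lead_coeff f) f"
  shows "degree (g - smult (lead_coeff g / lead_coeff f) f) < degree f"
proof -
  let ?h = "g - smult (lead_coeff g / lead_coeff f) f"
  have "degree ?h \<le> degree f"
    using assms by (intro degree_diff_le) (auto intro: degree_smult_le)
  moreover have "coeff ?h (degree f) = 0" using assms by simp
  then have "degree ?h \<noteq> degree f" using assms(3) leading_coeff_0_iff[of ?h] by auto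
  ultimately show ?thesis by simp
qed

text \<open>Nonzero polynomials of distinct degrees have a nonzero Wronskian. Equal degrees reduce
  to that case, since subtracting the multiple of \<open>f\<close> that cancels the leading term
  leaves the Wronskian with \<open>f\<close> unchanged.\<close>

lemma wronskian_eq_0_imp:
  assumes "f \<noteq> 0" and "wronskian g f = 0"
  shows "\<exists>b. g = smult b f"
proof (cases "degree g = degree f")
  case False
  then have "g = 0"
    using assms wronskian_nonzero[of f g] wronskian_nonzero[of g f] wronskian_commute[of f g]
    by (auto simp: neq_iff)
  then show ?thesis by (intro exI[of _ 0]) simp
next
  case True
  define b where "b = lead_coeff g / lead_coeff f"
  have "wronskian (g - smult b f) f = 0"
    using assms by (simp add: wronskian_diff_smult)
  then have "g - smult b f = 0" if "g \<noteq> smult b f"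
    using degree_cancel_less[OF True assms(1)] that wronskian_nonzero[of "g - smult b f" f]
      wronskian_commute[of f "g - smult b f"] by (auto simp: b_def)
  then show ?thesis by auto
qed

section \<open>Planes of polynomials\<close>

lemma vector_space_poly: "vector_space (smult :: complex \<Rightarrow> complex poly \<Rightarrow> complex poly)"
  by unfold_locales (auto simp: smult_add_right smult_add_left)

lemma plane_basis_iff:
  "plane_basis V g f \<longleftrightarrow>
     (\<forall>a b. smult a g + smult b f = 0 \<longrightarrow> a = 0 \<and> b = 0) \<and>
     V = {smult a g + smult b f | a b. True}"
proof -
  interpret vector_space "smult :: complex \<Rightarrow> complex poly \<Rightarrow> complex poly"
    by (rule vector_space_poly)
  have span: "span {g, f} = {smult a g + smult b f | a b. True}"
  proof (rule set_eqI)
    fix p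
    have "p \<in> span {g, f} \<longleftrightarrow> (\<exists>a b. p - smult a g = smult b f)"
      unfolding span_insert[of g] span_singleton by blast
    also have "\<dots> \<longleftrightarrow> p \<in> {smult a g + smult b f | a b. True}"
      by (simp add: diff_eq_eq add.commute)
    finally show "p \<in> span {g, f} \<longleftrightarrow> p \<in> {smult a g + smult b f | a b. True}" .
  qed
  have dep: "dependent {g, f} \<longleftrightarrow>
      (\<exists>u. (\<exists>v\<in>{g, f}. u v \<noteq> 0) \<and> (\<Sum>v\<in>{g, f}. smult (u v) v) = 0)"
    by (rule dependent_finite) simp
  have "g \<noteq> f \<and> \<not> dependent {g, f} \<longleftrightarrow> (\<forall>a b. smult a g + smult b f = 0 \<longrightarrow> a = 0 \<and> b = 0)"
    (is "?L \<longleftrightarrow> ?R")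
  proof
    assume L: ?L
    then have ne: "g \<noteq> f" "f \<noteq> g" by auto
    have indep: "\<not> ((\<exists>v\<in>{g, f}. u v \<noteq> 0) \<and> (\<Sum>v\<in>{g, f}. smult (u v) v) = 0)" for u
      using L dep by blast
    show ?R
    proof (intro allI impI)
      fix a b assume ab: "smult a g + smult b f = 0"
      have "(\<Sum>v\<in>{g, f}. smult (if v = g then a else b) v) = smult a g + smult b f"
        by (subst sum.insert) (simp_all add: ne del: scale_eq_0_iff)
      then have "(\<Sum>v\<in>{g, f}. smult (if v = g then a else b) v) = 0"
        by (simp only: ab)
      then have "\<forall>v\<in>{g, f}. (if v = g then a else b) = 0"
        using indep[of "\<lambda>v. if v = g then a else b"] by blast
      then show "a = 0 \<and> b = 0" using ne by auto
    qed
  next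
    assume R: ?R
    \<comment> \<open>If \<open>g = f\<close>, the coefficients 1 and -1 would give a nontrivial
      relation.\<close>
    then have ne: "g \<noteq> f" using R[THEN spec, THEN spec, of 1 "-1"] by fastforce
    have "\<forall>v\<in>{g, f}. u v = 0" if "(\<Sum>v\<in>{g, f}. smult (u v) v) = 0" for u
    proof -
      have "(\<Sum>v\<in>{g, f}. smult (u v) v) = smult (u g) g + smult (u f) f"
        by (subst sum.insert) (simp_all add: ne)
      then have "smult (u g) g + smult (u f) f = 0" by (simp only: that)
      then show ?thesis using R by blast
    qed
    then have "\<not> dependent {g, f}" unfolding dep by blast
    then show ?L using ne by blast
  qed
  then show ?thesis unfolding plane_basis_def span by (metis (lifting))
qed

lemma is_plane_iff: "is_plane V \<longleftrightarrow> (\<exists>g f. plane_basis V g f)"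
proof -
  interpret vector_space "smult :: complex \<Rightarrow> complex poly \<Rightarrow> complex poly"
    by (rule vector_space_poly)
  show ?thesis
  proof
    assume V: "is_plane V"
    obtain B where B: "B \<subseteq> V" "independent B" "V \<subseteq> span B" "card B = 2"
      using V basis_exists[of V] by (auto simp: is_plane_def)
    then obtain g f where "B = {g, f}" "g \<noteq> f" by (auto simp: card_2_iff)
    moreover have "span B = V" using B V by (intro span_subspace) (auto simp: is_plane_def)
    ultimately show "\<exists>g f. plane_basis V g f" using B unfolding plane_basis_def by blast
  next
    assume "\<exists>g f. plane_basis V g f"
    then obtain g f where "g \<noteq> f" "independent {g, f}" "span {g, f} = V"
      by (auto simp: plane_basis_def)
    moreover from this have "dim (span {g, f}) = 2"
      using dim_span_eq_card_independent[of "{g, f}"] by simp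
    ultimately show "is_plane V" unfolding is_plane_def using subspace_span by blast
  qed
qed

lemma plane_basis_change:
  assumes "plane_basis V g f" and "a \<noteq> 0"
  shows "plane_basis V g (smult a f + smult b g)"
proof -
  have *: "smult u g + smult v (smult a f + smult b g) = smult (u + v * b) g + smult (v * a) f" for u v
    by (simp add: smult_add_right smult_add_left algebra_simps)
  have indep: "smult u g + smult v f = 0 \<Longrightarrow> u = 0 \<and> v = 0" for u v
    using assms(1) unfolding plane_basis_iff by blast
  have "smult u g + smult v f \<in> {smult (u' + v' * b) g + smult (v' * a) f | u' v'. True}" for u v
    \<comment> \<open>The witnesses solve \<open>v' * a = v\<close> and
      \<open>u' + v' * b = u\<close>.\<close>
    using assms(2) by (intro CollectI exI[of _ "u - v / a * b"] exI[of _ "v / a"]) simp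
  then have "V = {smult (u' + v' * b) g + smult (v' * a) f | u' v'. True}"
    using assms(1) unfolding plane_basis_iff by blast
  moreover have "u = 0 \<and> v = 0" if "smult (u + v * b) g + smult (v * a) f = 0" for u v
    using indep[OF that] assms(2) by auto
  ultimately show ?thesis unfolding plane_basis_iff * by blast
qed

lemma plane_basis_commute: "plane_basis V g f \<longleftrightarrow> plane_basis V f g"
  unfolding plane_basis_def insert_commute[of g f "{}"] by blast

lemma plane_basis_nonzero:
  assumes "plane_basis V g f"
  shows "g \<noteq> 0" "f \<noteq> 0"
proof -
  have "smult a g + smult b f = 0 \<Longrightarrow> a = 0 \<and> b = 0" for a b
    using assms unfolding plane_basis_iff by blast
  from this[of 1 0] this[of 0 1] show "g \<noteq> 0" "f \<noteq> 0" by auto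
qed

lemma plane_basis_wronskian_nonzero:
  assumes "plane_basis V g f"
  shows "wronskian g f \<noteq> 0"
proof
  assume "wronskian g f = 0"
  then obtain b where b: "g = smult b f" using wronskian_eq_0_imp plane_basis_nonzero assms by blast
  have "smult a g + smult b f = 0 \<Longrightarrow> a = 0 \<and> b = 0" for a b
    using assms unfolding plane_basis_iff by blast
  from this[of 1 "-b"] b show False by simp
qed

text \<open>Order any basis by degree. If the degrees agree, cancelling leading terms lowers one of
  them, and independence keeps the difference nonzero.\<close>

lemma is_plane_echelon_basis:
  assumes "is_plane V"
  obtains g f where "plane_basis V g f" "degree f < degree g" "lead_coeff f = 1"
proof -
  obtain g0 f0 where "plane_basis V g0 f0" using assms unfolding is_plane_iff by blast
  moreover from this have "plane_basis V f0 g0" by (simp add: plane_basis_commute)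
  ultimately obtain g f where gf: "plane_basis V g f" "degree f \<le> degree g"
    using nat_le_linear[of "degree f0" "degree g0"] by auto
  have "\<exists>f. plane_basis V g f \<and> degree f < degree g"
  proof (cases "degree f = degree g")
    case False
    then show ?thesis using gf by auto
  next
    case True
    let ?c = "lead_coeff f / lead_coeff g"
    have f': "plane_basis V g (f - smult ?c g)"
      using plane_basis_change[OF gf(1), of 1 "- ?c"] by simp
    then show ?thesis
      using degree_cancel_less[OF True] plane_basis_nonzero[OF f'] plane_basis_nonzero[OF gf(1)] by force
  qed
  then obtain f where f: "plane_basis V g f" "degree f < degree g" by blast
  have "f \<noteq> 0" by (rule plane_basis_nonzero[OF f(1)])
  then show thesis
    using that[of g "smult (1 / lead_coeff f) f"] f plane_basis_change[OF f(1), of "1 / lead_coeff f" 0]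
    by simp
qed

lemma echelon_basis_degree:
  fixes g f :: "complex poly"
  assumes "degree f < degree g"
  shows "degree (smult a g + smult b f) = (if a = 0 then degree (smult b f) else degree g)"
proof (cases "a = 0")
  case False
  then show ?thesis using assms degree_smult_le[of b f]
    by (subst degree_add_eq_left) auto
qed simp

text \<open>With distinct degrees the top terms cannot cancel, so a member either has degree
  \<open>degree g\<close> or is a multiple of \<open>f\<close>. All three claims follow from this
  dichotomy.\<close>

lemma
  assumes V: "plane_basis V g f" and less: "degree f < degree g"
  shows plane_degree_echelon: "plane_degree V = degree g"
    and plane_order_echelon: "plane_order V = degree f"
    and plane_min_degree_echelon: "p \<in> V \<Longrightarrow> degree p = degree f \<Longrightarrow> \<exists>b. p = smult b f"
proof -
  have V_eq: "V = {smult a g + smult b f | a b. True}" using V by (simp add: plane_basis_iff)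
  have inV: "smult a g + smult b f \<in> V" for a b by (auto simp: V_eq)
  have g: "g \<in> V" and f: "f \<in> V" using inV[of 1 0] inV[of 0 1] by auto
  have f0: "f \<noteq> 0" using plane_basis_nonzero[OF V] by auto
  have V': "degree p = degree g \<or> (\<exists>b. p = smult b f)" if "p \<in> V" for p
    using that less by (force simp: V_eq echelon_basis_degree)
  have le: "degree p \<le> degree g" if "p \<in> V" for p
    using V'[OF that] less degree_smult_le[of _ f] by (auto intro: le_trans less_imp_le)
  have ge: "degree f \<le> degree p" if "p \<in> V" "p \<noteq> 0" for p
    using V'[OF that(1)] less that by auto
  have fin: "finite (degree ` V)" by (rule finite_subset[of _ "{..degree g}"]) (auto dest: le)
  show "plane_degree V = degree g" unfolding plane_degree_def
    by (rule Max_eqI) (use fin le g in auto)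
  show "plane_order V = degree f" unfolding plane_order_def
    by (rule Min_eqI) (use ge f f0 in \<open>auto intro: finite_subset[OF _ fin]\<close>)
  show "\<exists>b. p = smult b f" if "p \<in> V" "degree p = degree f" using V'[OF that(1)] that less by auto
qed

text \<open>Justifies the definite description: any other basis has a proportional Wronskian by
  \<open>wronskian_lincomb\<close>, and being monic fixes the factor.\<close>

lemma plane_wronskian_eqI:
  assumes V: "plane_basis V g f" and w: "lead_coeff w = 1" "w = smult c (wronskian g f)"
  shows "plane_wronskian V = w"
  unfolding plane_wronskian_def
proof (rule the_equality)
  show "lead_coeff w = 1 \<and> (\<exists>g f c. plane_basis V g f \<and> w = smult c (wronskian g f))"
    using assms by auto
next
  fix w' assume w': "lead_coeff w' = 1 \<and> (\<exists>g f c. plane_basis V g f \<and> w' = smult c (wronskian g f))"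
  then obtain g' f' c' where 1: "plane_basis V g' f'" "w' = smult c' (wronskian g' f')" by auto
  have inV: "smult a g' + smult b f' \<in> V" for a b using 1(1) by (auto simp: plane_basis_iff)
  obtain a1 b1 a2 b2 where "g' = smult a1 g + smult b1 f" "f' = smult a2 g + smult b2 f"
    using inV[of 1 0] inV[of 0 1] V by (auto simp: plane_basis_iff)
  then obtain e where e: "w' = smult e (wronskian g f)"
    using 1 wronskian_lincomb by (metis smult_smult)
  moreover have "c * lead_coeff (wronskian g f) = 1" "lead_coeff w' = 1"
    using w w' by (metis lead_coeff_smult)+
  moreover from this have "lead_coeff (wronskian g f) \<noteq> 0" by auto
  ultimately have "e = c" by (metis lead_coeff_smult mult_cancel_right)
  then show "w' = w" using w e by simp
qed

lemma plane_wronskian_basis: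
  assumes V: "plane_basis V g f"
  shows "\<exists>c. c \<noteq> 0 \<and> plane_wronskian V = smult c (wronskian g f)"
  using plane_wronskian_eqI[OF V _ refl, of "1 / lead_coeff (wronskian g f)"]
    plane_basis_wronskian_nonzero[OF V] by (intro exI[of _ "1 / lead_coeff (wronskian g f)"]) simp

section \<open>Solving the Wronskian equation\<close>

lemma pderiv_surj: "\<exists>h. pderiv h = p" for p :: "'a :: field_char_0 poly"
proof
  let ?h = "\<Sum>i\<le>degree p. monom (coeff p i / of_nat (Suc i)) (Suc i)"
  show "pderiv ?h = p"
  proof (rule poly_eqI)
    fix j
    have "coeff ?h (Suc j) = coeff p j / of_nat (Suc j)"
      by (auto simp: coeff_sum coeff_eq_0 simp del: of_nat_Suc)
    then show "coeff (pderiv ?h) j = coeff p j"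
      using of_nat_neq_0[of j, where 'a = 'a] by (simp add: coeff_pderiv del: of_nat_Suc)
  qed
qed

lemma poly_interpolation:
  fixes v :: "'a :: field \<Rightarrow> 'a"
  assumes "finite S"
  shows "\<exists>p. \<forall>s\<in>S. poly p s = v s"
  using assms
proof induction
  case (insert a S)
  then obtain p where p: "\<forall>s\<in>S. poly p s = v s" by blast
  \<comment> \<open>Newton step: \<open>?q\<close> vanishes on \<open>S\<close> but not at
    \<open>a\<close>, so adding a multiple of it corrects the value at \<open>a\<close>
    alone.\<close>
  let ?q = "\<Prod>s\<in>S. [:- s, 1:]"
  have "poly ?q a \<noteq> 0" using insert by (auto simp: poly_prod)
  moreover have "poly ?q s = 0" if "s \<in> S" for s using that insert by (auto simp: poly_prod)
  ultimately have "\<forall>s\<in>insert a S. poly (p + smult ((v a - poly p a) / poly ?q a) ?q) s = v s"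
    using p by auto
  then show ?case by blast
qed simp

lemma prod_linear_dvd:
  fixes p :: "'a :: field poly"
  assumes "finite S" and "\<And>s. s \<in> S \<Longrightarrow> poly p s = 0"
  shows "(\<Prod>s\<in>S. [:- s, 1:]) dvd p"
  using assms
proof induction
  case (insert a S)
  then obtain q where q: "p = (\<Prod>s\<in>S. [:- s, 1:]) * q" by (auto simp: dvd_def)
  have "poly (\<Prod>s\<in>S. [:- s, 1:]) a \<noteq> 0" using insert by (auto simp: poly_prod)
  then have "poly q a = 0" using insert.prems[of a] q by auto
  then have "[:- a, 1:] dvd q" by (simp add: poly_eq_0_iff_dvd)
  then have "[:- a, 1:] * (\<Prod>s\<in>S. [:- s, 1:]) dvd q * (\<Prod>s\<in>S. [:- s, 1:])" by (rule mult_dvd_mono) simp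
  then show ?case using insert.hyps q by (simp add: mult.commute)
qed simp

text \<open>Over the complex numbers, \<open>f\<close> is a constant times the product of its
  distinct linear factors, and each of these divides \<open>p\<close>.\<close>

lemma rsquarefree_dvd:
  fixes f p :: "complex poly"
  assumes f: "rsquarefree f" and "\<And>x. poly f x = 0 \<Longrightarrow> poly p x = 0"
  shows "f dvd p"
proof -
  have f0: "f \<noteq> 0" using f by (simp add: rsquarefree_def)
  have "(\<Prod>x | poly f x = 0. [:- x, 1:]) dvd p"
    using assms poly_roots_finite[OF f0] by (intro prod_linear_dvd) auto
  then have "smult (lead_coeff f) (\<Prod>x | poly f x = 0. [:- x, 1:]) dvd p"
    using f0 by (intro smult_dvd) auto
  then show ?thesis using complex_poly_decompose_rsquarefree[OF f] by simp
qed

text \<open>Ansatz \<open>g = u + f * h\<close>. Modulo \<open>f\<close> the equation says that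
  \<open>W\<close> is \<open>- u * pderiv f\<close>, which prescribes \<open>u\<close> at the roots
  of \<open>f\<close>. The hypothesis on the roots then makes the derivative required of
  \<open>h\<close> a polynomial, which is integrated.\<close>

lemma wronskian_solvable:
  assumes f: "rsquarefree f"
    and eq: "\<And>x. poly f x = 0 \<Longrightarrow> poly (W * pderiv (pderiv f) - pderiv W * pderiv f) x = 0"
  shows "\<exists>g. wronskian g f = W"
proof -
  have f': "poly (pderiv f) x \<noteq> 0" if "poly f x = 0" for x
    using f that by (auto simp: rsquarefree_roots)
  have "finite {x. poly f x = 0}"
    using f by (intro poly_roots_finite) (simp add: rsquarefree_def)
  from poly_interpolation[OF this, of "\<lambda>x. - poly W x / poly (pderiv f) x"]
  obtain u where u: "\<And>x. poly f x = 0 \<Longrightarrow> poly u x = - poly W x / poly (pderiv f) x" by auto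
  have "f dvd W + u * pderiv f"
    using f by (rule rsquarefree_dvd) (use f' u in auto)
  then obtain q where q: "W + u * pderiv f = f * q" by (auto simp: dvd_def)
  \<comment> \<open>The derivative of \<open>u / f + h\<close> is \<open>W / f\<^sup>2\<close> iff \<open>h' = (q - u') / f\<close>, so the latter must be a polynomial.\<close>
  have "f dvd q - pderiv u"
  proof (rule rsquarefree_dvd[OF f])
    fix x assume x: "poly f x = 0"
    have "poly (pderiv (W + u * pderiv f)) x = poly (pderiv (f * q)) x" by (simp only: q)
    then have "poly (pderiv W) x + poly u x * poly (pderiv (pderiv f)) x
             = poly (pderiv f) x * poly (q - pderiv u) x"
      using x by (simp add: pderiv_add pderiv_mult algebra_simps)
    \<comment> \<open>The extra factor \<open>pderiv f\<close> allows the product of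
      \<open>u\<close> and \<open>pderiv f\<close> at \<open>x\<close> to be replaced by
      \<open>- W\<close>; the left side becomes the negative of the expression in
      \<open>eq\<close>.\<close>
    then have "poly (pderiv f) x * (poly (pderiv W) x + poly u x * poly (pderiv (pderiv f)) x)
             = (poly (pderiv f) x)\<^sup>2 * poly (q - pderiv u) x"
      by (simp only: power2_eq_square mult.assoc)
    moreover have "poly (pderiv f) x * (poly (pderiv W) x + poly u x * poly (pderiv (pderiv f)) x) = 0"
      using eq[OF x] f'[OF x] by (simp add: u[OF x] field_simps)
    ultimately show "poly (q - pderiv u) x = 0" using f'[OF x] by auto
  qed
  then obtain e where e: "q - pderiv u = f * e" by (auto simp: dvd_def)
  obtain h where h: "pderiv h = e" using pderiv_surj by blast
  have "wronskian (u + f * h) f = f * (pderiv u + f * e) - u * pderiv f"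
    by (simp add: wronskian_def pderiv_add pderiv_mult h algebra_simps)
  also have "\<dots> = W" using q e by (simp add: algebra_simps)
  finally show ?thesis by blast
qed

text \<open>At a root of \<open>f\<close>, both \<open>c * W\<close> and \<open>c * pderiv W\<close>
  reduce to \<open>- g\<close> times \<open>pderiv f\<close> and \<open>pderiv (pderiv f)\<close>
  respectively, so the two products cancel.\<close>

lemma wronskian_root_identity:
  assumes "wronskian g f = smult c W" and "c \<noteq> 0" and "poly f x = 0"
  shows "poly (W * pderiv (pderiv f) - pderiv W * pderiv f) x = 0"
proof -
  have W: "W = smult (1 / c) (wronskian g f)" using assms by simp
  have "pderiv W = smult (1 / c) (pderiv (pderiv g) * f - g * pderiv (pderiv f))"
    by (simp only: W pderiv_smult pderiv_wronskian)
  then show ?thesis using assms(3) by (simp add: W wronskian_def algebra_simps)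
qed

text \<open>Describes the span of \<open>f\<close> and a solution \<open>g\<close> of the Wronskian
  equation without choosing \<open>g\<close>, which is determined only up to multiples of
  \<open>f\<close>.\<close>

definition wronskian_plane :: "complex poly \<Rightarrow> complex poly \<Rightarrow> complex poly set" where
  "wronskian_plane W f = {p. \<exists>c. wronskian p f = smult c W}"

lemma self_in_wronskian_plane: "f \<in> wronskian_plane W f"
  by (auto simp: wronskian_plane_def intro: exI[of _ 0])

text \<open>The linear map sending \<open>p\<close> to \<open>wronskian p f\<close> has the line of
  \<open>f\<close> as its kernel, and \<open>g\<close> maps to a generator of the line of
  \<open>W\<close>. The preimage of that line is therefore spanned by \<open>g\<close> and
  \<open>f\<close>.\<close>

lemma wronskian_plane_basis:
  assumes g: "wronskian g f = smult c W" and "c \<noteq> 0" "W \<noteq> 0"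
  shows "plane_basis (wronskian_plane W f) g f"
proof -
  have f0: "f \<noteq> 0" using assms by (auto simp: wronskian_def)
  have lin: "wronskian (smult a g + smult b f) f = smult (a * c) W" for a b
    using wronskian_lincomb[of a g b f 0 1] g by simp
  have "a = 0 \<and> b = 0" if "smult a g + smult b f = 0" for a b
  proof -
    have "smult (a * c) W = 0" using lin[of a b] that by (simp add: wronskian_def)
    then show ?thesis using that assms f0 by simp
  qed
  moreover have "p \<in> {smult a g + smult b f | a b. True}" if "p \<in> wronskian_plane W f" for p
  proof -
    obtain e where e: "wronskian p f = smult e W" using \<open>p \<in> _\<close> by (auto simp: wronskian_plane_def)
    then have "wronskian (p - smult (e / c) g) f = 0"
      using assms by (simp add: wronskian_diff_smult)
    then obtain b where "p - smult (e / c) g = smult b f" using wronskian_eq_0_imp f0 by blast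
    then have "p = smult (e / c) g + smult b f" by (simp add: diff_eq_eq add.commute)
    then show ?thesis by blast
  qed
  moreover have "smult a g + smult b f \<in> wronskian_plane W f" for a b
    using lin by (auto simp: wronskian_plane_def)
  ultimately show ?thesis unfolding plane_basis_iff by blast
qed

text \<open>From root polynomials to planes: counting degrees shows that a solution \<open>g\<close>
  of the Wronskian equation has degree \<open>d\<close>, so \<open>g\<close> and \<open>f\<close>
  form an echelon basis from which degree, order and Wronskian are read off.\<close>

lemma
  assumes f: "rsquarefree f" and deg: "0 < degree f" "degree f < d"
    and W: "lead_coeff W = 1" "degree W = d + degree f - 1"
    and coprime: "\<And>x. poly f x = 0 \<Longrightarrow> poly W x \<noteq> 0"
    and eq: "\<And>x. poly f x = 0 \<Longrightarrow> poly (W * pderiv (pderiv f) - pderiv W * pderiv f) x = 0"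
  shows nondegenerate_wronskian_plane: "nondegenerate_plane (wronskian_plane W f)"
    and degree_wronskian_plane: "plane_degree (wronskian_plane W f) = d"
    and wronskian_wronskian_plane: "plane_wronskian (wronskian_plane W f) = W"
    and wronskian_plane_min_degree:
      "p \<in> wronskian_plane W f \<Longrightarrow> degree p = degree f \<Longrightarrow> \<exists>b. p = smult b f"
proof -
  obtain g where g: "wronskian g f = W" using wronskian_solvable[OF f eq] by blast
  have "W \<noteq> 0" using W by auto
  then have basis: "plane_basis (wronskian_plane W f) g f"
    using g by (intro wronskian_plane_basis[of g f 1]) auto
  have f0: "f \<noteq> 0" using deg by auto
  have less: "degree f < degree g"
  proof (rule ccontr)
    assume "\<not> degree f < degree g"
    \<comment> \<open>Otherwise the Wronskian would have degree at most
      \<open>2 * degree f - 1\<close>, which is less than \<open>d + degree f - 1\<close>.\<close>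
    then show False using degree_wronskian_le[of g f] g W deg by simp
  qed
  have dg: "degree g = d" using degree_wronskian[OF less f0] g W deg by simp
  show d: "plane_degree (wronskian_plane W f) = d" using plane_degree_echelon[OF basis less] dg by simp
  show "plane_wronskian (wronskian_plane W f) = W"
    using plane_wronskian_eqI[OF basis W(1), of 1] g by simp
  show min: "\<exists>b. p = smult b f" if "p \<in> wronskian_plane W f" "degree p = degree f" for p
    using plane_min_degree_echelon[OF basis less] that by blast
  have in_plane: "smult a g + smult b f \<in> wronskian_plane W f" for a b
    using basis unfolding plane_basis_iff by blast
  have g_in: "g \<in> wronskian_plane W f" using in_plane[of 1 0] by simp
  \<comment> \<open>Away from the roots of \<open>f\<close> the witness is \<open>f\<close> itself.
    At a root, \<open>W\<close> equals \<open>- g * pderiv f\<close>, so \<open>g\<close> cannot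
    vanish there.\<close>
  have "\<exists>p\<in>wronskian_plane W f. poly p x \<noteq> 0" for x
  proof (cases "poly f x = 0")
    case True
    then have "poly g x \<noteq> 0" using coprime[OF True] g by (auto simp: wronskian_def)
    then show ?thesis using g_in by blast
  qed (use self_in_wronskian_plane in blast)
  then have "generic_plane (wronskian_plane W f)"
    using basis by (auto simp: generic_plane_def is_plane_iff)
  moreover have "rsquarefree p"
    if "p \<in> wronskian_plane W f" "degree p = degree f" for p
  proof -
    obtain b where "p = smult b f" using min \<open>p \<in> _\<close> \<open>degree p = _\<close> by blast
    \<comment> \<open>The positive degree of \<open>p\<close> rules out
      \<open>b = 0\<close>.\<close>
    then show ?thesis using f that deg by (cases "b = 0") (auto simp: rsquarefree_roots pderiv_smult)
  qed
  ultimately show "nondegenerate_plane (wronskian_plane W f)"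
    using plane_order_echelon[OF basis less] deg by (auto simp: nondegenerate_plane_def)
qed

text \<open>From planes to root polynomials: \<open>f\<close> is the monic member of least degree,
  taken from an echelon basis. Nondegeneracy gives it simple roots, and genericity keeps these away
  from the roots of the Wronskian.\<close>

lemma nondegenerate_plane_eq_wronskian_plane:
  assumes V: "nondegenerate_plane V"
  obtains f where "lead_coeff f = 1" "rsquarefree f"
    "degree (plane_wronskian V) = plane_degree V + degree f - 1"
    "V = wronskian_plane (plane_wronskian V) f"
    "\<forall>x. poly f x = 0 \<longrightarrow> poly (plane_wronskian V) x \<noteq> 0 \<and>
       poly (plane_wronskian V * pderiv (pderiv f) - pderiv (plane_wronskian V) * pderiv f) x = 0"
proof -
  have "is_plane V" and generic: "\<exists>p\<in>V. poly p x \<noteq> 0" for x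
    using V by (auto simp: nondegenerate_plane_def generic_plane_def)
  then obtain g f where gf: "plane_basis V g f" "degree f < degree g" "lead_coeff f = 1"
    using is_plane_echelon_basis by blast
  have f0: "f \<noteq> 0" using gf(3) by auto
  obtain c where c: "c \<noteq> 0" "plane_wronskian V = smult c (wronskian g f)"
    using plane_wronskian_basis[OF gf(1)] by blast
  have g: "wronskian g f = smult (1 / c) (plane_wronskian V)" using c by simp
  have W0: "plane_wronskian V \<noteq> 0" using c plane_basis_wronskian_nonzero[OF gf(1)] by simp
  have in_V: "smult a g + smult b f \<in> V" for a b using gf(1) unfolding plane_basis_iff by blast
  have "f \<in> V" using in_V[of 0 1] by simp
  then have f: "rsquarefree f"
    using V plane_order_echelon[OF gf(1,2)] by (simp add: nondegenerate_plane_def)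
  have "degree (plane_wronskian V) = plane_degree V + degree f - 1"
    using degree_wronskian[OF gf(2) f0] plane_degree_echelon[OF gf(1,2)] c by simp
  moreover have "V = wronskian_plane (plane_wronskian V) f"
  proof -
    \<comment> \<open>The two planes coincide because they share a basis.\<close>
    have "plane_basis (wronskian_plane (plane_wronskian V) f) g f"
      using wronskian_plane_basis[OF g] c W0 by simp
    then show ?thesis using gf(1) unfolding plane_basis_iff by blast
  qed
  moreover have "poly (plane_wronskian V) x \<noteq> 0" if x: "poly f x = 0" for x
  proof -
    \<comment> \<open>At a root of \<open>f\<close>, only the \<open>g\<close> component of a member
      not vanishing there can contribute, so \<open>g\<close> is nonzero at
      \<open>x\<close>.\<close>
    obtain a b where "poly (smult a g + smult b f) x \<noteq> 0"
      using generic[of x] gf(1) unfolding plane_basis_iff by blast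
    then have "poly g x \<noteq> 0" using x by auto
    moreover have "poly (pderiv f) x \<noteq> 0" using f x by (auto simp: rsquarefree_roots)
    ultimately show ?thesis using c x by (simp add: wronskian_def)
  qed
  moreover have "poly (plane_wronskian V * pderiv (pderiv f) - pderiv (plane_wronskian V) * pderiv f) x = 0"
    if "poly f x = 0" for x
    using wronskian_root_identity[OF g _ that] c by simp
  ultimately show thesis using that[of f] gf(3) f by blast
qed

section \<open>Critical points and their orbits\<close>

text \<open>Isolates the dependence on one coordinate: every other coordinate meets it in exactly
  one squared difference, and all remaining factors are constant.\<close>

lemma master_function_upd:
  assumes inj: "inj_on t {1..k}" and i: "i \<in> {1..k}"
    and W: "\<And>l. l \<in> {1..k} \<Longrightarrow> poly W (t l) \<noteq> 0"
  shows "\<exists>C. C \<noteq> 0 \<and> (\<forall>w. master_function k W (t(i := w)) =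
           C * (poly (\<Prod>l\<in>{1..k} - {i}. [:- t l, 1:]) w)\<^sup>2 / poly W w)"
proof -
  \<comment> \<open>\<open>c l\<close> collects the factors of row \<open>l\<close> that do not
    involve coordinate \<open>i\<close>.\<close>
  define c where "c l = (\<Prod>j\<in>{1..<l} - {i}. (t j - t l)\<^sup>2)" for l
  define C where "C = (\<Prod>l\<in>{1..k} - {i}. c l) / (\<Prod>l\<in>{1..k} - {i}. poly W (t l))"
  have t_eq: "t a = t b \<longleftrightarrow> a = b" if "a \<in> {1..k}" "b \<in> {1..k}" for a b
    using inj that by (auto dest: inj_onD)
  have "c l \<noteq> 0" if "l \<in> {1..k}" for l
    using that by (auto simp: c_def t_eq)
  then have "C \<noteq> 0" using W by (auto simp: C_def)
  moreover have "master_function k W (t(i := w)) =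
      C * (poly (\<Prod>l\<in>{1..k} - {i}. [:- t l, 1:]) w)\<^sup>2 / poly W w" for w
  proof -
    let ?u = "t(i := w)"
    \<comment> \<open>The factor for the pair of \<open>l\<close> and \<open>i\<close> sits in row
      \<open>i\<close> when \<open>l < i\<close> and in row \<open>l\<close> when
      \<open>i < l\<close>. The two complementary conditionals later merge into one product over all
      \<open>l\<close> other than \<open>i\<close>.\<close>
    have row_i: "(\<Prod>j\<in>{1..<i}. (?u j - ?u i)\<^sup>2) =
        (\<Prod>l\<in>{1..k} - {i}. if l < i then (w - t l)\<^sup>2 else 1)"
      by (rule prod.mono_neutral_cong_left) (use i in \<open>auto simp: power2_commute\<close>)
    have row: "(\<Prod>j\<in>{1..<l}. (?u j - ?u l)\<^sup>2) = c l * (if i < l then (w - t l)\<^sup>2 else 1)"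
      if l: "l \<in> {1..k} - {i}" for l
    proof (cases "i < l")
      case True
      then have "(\<Prod>j\<in>{1..<l}. (?u j - ?u l)\<^sup>2) = (w - t l)\<^sup>2 * (\<Prod>j\<in>{1..<l} - {i}. (?u j - ?u l)\<^sup>2)"
        using i l by (subst prod.remove[of _ i]) auto
      also have "(\<Prod>j\<in>{1..<l} - {i}. (?u j - ?u l)\<^sup>2) = c l"
        unfolding c_def using l by (intro prod.cong) auto
      finally show ?thesis using True by simp
    next
      case False
      then have "(\<Prod>j\<in>{1..<l}. (?u j - ?u l)\<^sup>2) = c l"
        unfolding c_def using l by (intro prod.cong) auto
      then show ?thesis using False by simp
    qed
    have "(\<Prod>l\<in>{1..k}. \<Prod>j\<in>{1..<l}. (?u j - ?u l)\<^sup>2) =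
        (\<Prod>l\<in>{1..k} - {i}. if l < i then (w - t l)\<^sup>2 else 1) *
        (\<Prod>l\<in>{1..k} - {i}. c l * (if i < l then (w - t l)\<^sup>2 else 1))"
      unfolding row_i[symmetric] by (subst prod.remove[OF _ i]) (simp_all only: row finite_atLeastAtMost cong: prod.cong)
    also have "\<dots> = (\<Prod>l\<in>{1..k} - {i}. c l) * (\<Prod>l\<in>{1..k} - {i}. (w - t l)\<^sup>2)"
      unfolding prod.distrib[symmetric] by (rule prod.cong) auto
    finally have "(\<Prod>l\<in>{1..k}. \<Prod>j\<in>{1..<l}. (?u j - ?u l)\<^sup>2) =
        (\<Prod>l\<in>{1..k} - {i}. c l) * (poly (\<Prod>l\<in>{1..k} - {i}. [:- t l, 1:]) w)\<^sup>2"
      by (simp add: poly_prod prod_power_distrib)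
    moreover have "(\<Prod>l\<in>{1..k}. poly W (?u l)) = poly W w * (\<Prod>l\<in>{1..k} - {i}. poly W (t l))"
      using i by (subst prod.remove[OF _ i]) auto
    ultimately show ?thesis by (simp add: master_function_def C_def field_simps)
  qed
  ultimately show ?thesis by blast
qed

text \<open>Write \<open>f\<close> as \<open>[:- t i, 1:] * h\<close>. At \<open>t i\<close> the
  first two derivatives of \<open>f\<close> are \<open>h\<close> and \<open>2 * pderiv h\<close>,
  while the derivative of \<open>C * h^2 / W\<close> vanishes iff
  \<open>2 * pderiv h * W = h * pderiv W\<close> there.\<close>

lemma master_function_critical_iff:
  assumes inj: "inj_on t {1..k}" and i: "i \<in> {1..k}"
    and W: "\<And>l. l \<in> {1..k} \<Longrightarrow> poly W (t l) \<noteq> 0"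
  defines "f \<equiv> \<Prod>l=1..k. [:- t l, 1:]"
  shows "((\<lambda>w. master_function k W (t(i := w))) has_field_derivative 0) (at (t i)) \<longleftrightarrow>
         poly (W * pderiv (pderiv f) - pderiv W * pderiv f) (t i) = 0"
proof -
  define h where "h = (\<Prod>l\<in>{1..k} - {i}. [:- t l, 1:])"
  obtain C where C: "C \<noteq> 0"
    "\<And>w. master_function k W (t(i := w)) = C * (poly h w)\<^sup>2 / poly W w"
    using master_function_upd[OF inj i W] unfolding h_def by blast
  define x where "x = t i"
  have Wx: "poly W x \<noteq> 0" using W[OF i] by (simp add: x_def)
  \<comment> \<open>Distinct coordinates make \<open>h\<close> nonzero at \<open>x\<close>, so it
    can be cancelled from the derivative.\<close>
  have hx: "poly h x \<noteq> 0" using inj i by (auto simp: h_def x_def poly_prod dest: inj_onD)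
  have "f = [:- x, 1:] * h"
    unfolding f_def h_def x_def by (rule prod.remove) (use i in auto)
  moreover have "pderiv [:- x, 1:] = 1" by (simp add: pderiv_pCons)
  ultimately have "pderiv f = h + [:- x, 1:] * pderiv h"
    and "pderiv (pderiv f) = 2 * pderiv h + [:- x, 1:] * pderiv (pderiv h)"
    by (simp_all only: pderiv_mult pderiv_add mult_2 add_ac mult_1_right)
  then have f': "poly (pderiv f) x = poly h x" "poly (pderiv (pderiv f)) x = 2 * poly (pderiv h) x"
    by simp_all
  let ?D = "C * poly h x * (2 * poly (pderiv h) x * poly W x - poly h x * poly (pderiv W) x) / (poly W x)\<^sup>2"
  have "((\<lambda>w. C * (poly h w)\<^sup>2 / poly W w) has_field_derivative ?D) (at x)"
    using Wx by (auto intro!: derivative_eq_intros poly_DERIV simp: field_simps power2_eq_square)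
  then have "((\<lambda>w. master_function k W (t(i := w))) has_field_derivative ?D) (at x)"
    by (simp add: C(2))
  then have "((\<lambda>w. master_function k W (t(i := w))) has_field_derivative 0) (at x) \<longleftrightarrow> ?D = 0"
    by (metis DERIV_unique)
  also have "\<dots> \<longleftrightarrow> poly (W * pderiv (pderiv f) - pderiv W * pderiv f) x = 0"
    using C(1) Wx hx by (simp add: f' algebra_simps)
  finally show ?thesis by (simp add: x_def)
qed

section \<open>Orbits of points and their root polynomials\<close>

lemma perm_orbit_permute:
  assumes \<sigma>: "\<sigma> permutes {1..k}"
  shows "perm_orbit k (t \<circ> \<sigma>) = perm_orbit k t"
proof -
  have "t \<circ> \<tau> = t \<circ> \<sigma> \<circ> (inv \<sigma> \<circ> \<tau>)" for \<tau>
    by (simp add: fun_eq_iff permutes_inverses(1)[OF \<sigma>])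
  moreover have "inv \<sigma> \<circ> \<tau> permutes {1..k}" "\<sigma> \<circ> \<tau> permutes {1..k}" if "\<tau> permutes {1..k}" for \<tau>
    using that \<sigma> by (auto intro: permutes_compose permutes_inv)
  ultimately show ?thesis unfolding perm_orbit_def by (auto simp: comp_assoc)
qed

lemma perm_orbit_self: "t \<in> perm_orbit k t"
  unfolding perm_orbit_def by (intro CollectI exI[of _ id]) (simp add: permutes_id)

text \<open>Both points list the same set without repetition, so matching equal values defines the
  required permutation of indices.\<close>

lemma perm_orbit_eqI:
  assumes ext: "t \<in> extensional {1..k}" "t' \<in> extensional {1..k}"
    and inj: "inj_on t {1..k}" "inj_on t' {1..k}" and img: "t ` {1..k} = t' ` {1..k}"
  shows "perm_orbit k t = perm_orbit k t'"
proof -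
  define \<sigma> where "\<sigma> x = (if x \<in> {1..k} then inv_into {1..k} t' (t x) else x)" for x
  have "bij_betw (inv_into {1..k} t' \<circ> t) {1..k} {1..k}"
    using inj img by (intro bij_betw_trans[of _ _ "t ` {1..k}"] bij_betw_inv_into) (auto simp: bij_betw_def)
  then have "bij_betw \<sigma> {1..k} {1..k}"
    by (rule bij_betw_cong[THEN iffD1, rotated]) (simp add: \<sigma>_def)
  then have "\<sigma> permutes {1..k}"
    by (rule bij_imp_permutes) (simp only: \<sigma>_def if_False)
  moreover have "t = t' \<circ> \<sigma>"
  proof
    fix x show "t x = (t' \<circ> \<sigma>) x"
    proof (cases "x \<in> {1..k}")
      case True
      then have "t x \<in> t' ` {1..k}" using img by blast
      then show ?thesis using True by (simp add: \<sigma>_def f_inv_into_f)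
    next
      case False
      \<comment> \<open>Outside \<open>{1..k}\<close> both points take the default
        \<open>undefined\<close>, so they agree there as functions.\<close>
      then have "t x = undefined" "t' x = undefined" "\<sigma> x = x"
        using ext by (auto simp: extensional_def \<sigma>_def)
      then show ?thesis by simp
    qed
  qed
  ultimately show ?thesis by (simp only: perm_orbit_permute)
qed

definition root_poly :: "nat \<Rightarrow> (nat \<Rightarrow> complex) \<Rightarrow> complex poly" where
  "root_poly k t = (\<Prod>i=1..k. [:- t i, 1:])"

lemma degree_root_poly: "degree (root_poly k t) = k"
  by (simp add: root_poly_def degree_prod_sum_eq)

lemma lead_coeff_root_poly: "lead_coeff (root_poly k t) = 1"
  by (simp only: root_poly_def lead_coeff_prod) simp

lemma poly_root_poly_eq_0_iff: "poly (root_poly k t) x = 0 \<longleftrightarrow> x \<in> t ` {1..k}"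
  by (auto simp: root_poly_def poly_prod)

lemma root_poly_permute:
  assumes "\<sigma> permutes {1..k}"
  shows "root_poly k (t \<circ> \<sigma>) = root_poly k t"
  using prod.permute[OF assms, of "\<lambda>i. [:- t i, 1:]"] by (simp add: root_poly_def comp_def)

lemma rsquarefree_root_poly:
  assumes "inj_on t {1..k}"
  shows "rsquarefree (root_poly k t)"
  unfolding rsquarefree_roots
proof (intro allI notI)
  fix x assume x: "poly (root_poly k t) x = 0 \<and> poly (pderiv (root_poly k t)) x = 0"
  then obtain i where i: "i \<in> {1..k}" "x = t i" by (auto simp: poly_root_poly_eq_0_iff)
  define h where "h = (\<Prod>l\<in>{1..k} - {i}. [:- t l, 1:])"
  have "root_poly k t = [:- x, 1:] * h"
    unfolding root_poly_def h_def i(2) by (rule prod.remove) (use i in auto)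
  moreover have "pderiv [:- x, 1:] = 1" by (simp add: pderiv_pCons)
  ultimately have "pderiv (root_poly k t) = h + [:- x, 1:] * pderiv h"
    by (simp only: pderiv_mult add_ac mult_1_right)
  moreover have "poly h x \<noteq> 0" using assms i by (auto simp: h_def poly_prod dest: inj_onD)
  ultimately show False using x by simp
qed

lemma monic_rsquarefree_eq_root_poly:
  assumes f: "rsquarefree f" "lead_coeff f = 1"
  obtains t where "t \<in> extensional {1..degree f}" "inj_on t {1..degree f}" "f = root_poly (degree f) t"
proof -
  let ?S = "{x. poly f x = 0}"
  have fin: "finite ?S" using f by (intro poly_roots_finite) auto
  have eq: "f = (\<Prod>x\<in>?S. [:- x, 1:])" using complex_poly_decompose_rsquarefree[OF f(1)] f(2) by simp
  have "degree (\<Prod>x\<in>?S. [:- x, 1:]) = card ?S" by (simp add: degree_prod_sum_eq)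
  then have card: "degree f = card ?S" using eq by simp
  obtain b where b: "bij_betw b {1..card ?S} ?S" using ex_bij_betw_nat_finite_1[OF fin] by blast
  \<comment> \<open>The enumeration of the roots is restricted so that it is a point in the
    extensional encoding.\<close>
  define t where "t = restrict b {1..card ?S}"
  have bij: "bij_betw t {1..card ?S} ?S"
    using b by (rule bij_betw_cong[THEN iffD1, rotated]) (simp add: t_def)
  have "f = root_poly (card ?S) t"
    unfolding root_poly_def using eq prod.reindex_bij_betw[OF bij, of "\<lambda>x. [:- x, 1:]"] by simp
  then show thesis using that[of t] bij card by (simp add: bij_betw_def t_def)
qed

text \<open>The second conjunct pins \<open>F\<close> down: a plane with Wronskian \<open>W\<close>
  that contains the root polynomial \<open>f\<close> of \<open>t\<close> can only be
  \<open>wronskian_plane W f\<close>.\<close>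

theorem corollary2:
  fixes n d M k :: nat and m :: "nat \<Rightarrow> nat" and z :: "nat \<Rightarrow> complex" and W :: "complex poly"
  assumes "n > 0" and "d > 0"
    and "M = (\<Sum>j=1..n. m j)"
    and "d - 1 < M" and "M \<le> 2 * d - 2"
    and "\<And>j. j \<in> {1..n} \<Longrightarrow> 1 \<le> m j \<and> m j \<le> d - 1"
    and "inj_on z {1..n}"
    and "W = (\<Prod>j=1..n. [:- z j, 1:] ^ m j)"
    and "k = M + 1 - d"
  shows "\<exists>F. bij_betw F (perm_orbit k ` critical_points k n z W)
               {V. nondegenerate_plane V \<and> plane_degree V = d \<and> plane_wronskian V = W} \<and>
             (\<forall>t\<in>critical_points k n z W. (\<Prod>i=1..k. [:- t i, 1:]) \<in> F (perm_orbit k t))"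
proof -
  let ?planes = "{V. nondegenerate_plane V \<and> plane_degree V = d \<and> plane_wronskian V = W}"
  let ?C = "critical_points k n z W"
  \<comment> \<open>The lower bound on \<open>M\<close> makes \<open>k\<close> positive, and the
    upper bound gives \<open>k < d\<close>, so a root polynomial can be the member of least
    degree.\<close>
  have k: "0 < k" "k < d" "M = d + k - 1" using assms(2,4,5,9) by auto
  have W_lead: "lead_coeff W = 1" by (simp only: assms(8) lead_coeff_prod lead_coeff_power) simp
  have W_deg: "degree W = M" by (simp add: assms(3,8) degree_prod_sum_eq degree_power_eq)
  \<comment> \<open>As every \<open>m j\<close> is positive, the points excluded from the
    configuration space are exactly the roots of \<open>W\<close>.\<close>
  have W_root: "poly W x = 0 \<longleftrightarrow> x \<in> z ` {1..n}" for x
    using assms(6) by (fastforce simp: assms(8) poly_prod poly_power)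
  have config_iff: "t \<in> config_space k n z \<longleftrightarrow>
      t \<in> extensional {1..k} \<and> inj_on t {1..k} \<and> (\<forall>l\<in>{1..k}. poly W (t l) \<noteq> 0)" for t
    unfolding config_space_def W_root by (auto simp: PiE_def inj_on_def)
  have critical_iff: "t \<in> ?C \<longleftrightarrow>
      t \<in> extensional {1..k} \<and> inj_on t {1..k} \<and> (\<forall>x. poly (root_poly k t) x = 0 \<longrightarrow> poly W x \<noteq> 0 \<and>
        poly (W * pderiv (pderiv (root_poly k t)) - pderiv W * pderiv (root_poly k t)) x = 0)" for t
  proof -
    have "(\<forall>i\<in>{1..k}. ((\<lambda>w. master_function k W (t(i := w))) has_field_derivative 0) (at (t i))) \<longleftrightarrow>
        (\<forall>i\<in>{1..k}. poly (W * pderiv (pderiv (root_poly k t)) - pderiv W * pderiv (root_poly k t)) (t i) = 0)"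
      if "t \<in> config_space k n z"
      unfolding root_poly_def using that by (intro ball_cong refl master_function_critical_iff) (auto simp: config_iff)
    then show ?thesis
      unfolding critical_points_def poly_root_poly_eq_0_iff mem_Collect_eq config_iff by blast
  qed
  \<comment> \<open>A union over the orbit avoids choosing a representative; all its terms coincide
    because \<open>root_poly\<close> is invariant under permutations.\<close>
  define F where "F X = {p. \<exists>t\<in>X. p \<in> wronskian_plane W (root_poly k t)}" for X
  have F: "F (perm_orbit k t) = wronskian_plane W (root_poly k t)" for t
    using perm_orbit_self[of t k] by (auto simp: F_def perm_orbit_def root_poly_permute)
  have plane: "wronskian_plane W (root_poly k t) \<in> ?planes" if "t \<in> ?C" for t
    using that k W_lead W_deg unfolding critical_iff
    by (intro CollectI conjI nondegenerate_wronskian_plane degree_wronskian_plane wronskian_wronskian_plane)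
      (auto simp: degree_root_poly rsquarefree_root_poly)
  have inj: "perm_orbit k t = perm_orbit k t'"
    if t: "t \<in> ?C" "t' \<in> ?C" and eq: "wronskian_plane W (root_poly k t) = wronskian_plane W (root_poly k t')"
    for t t'
  proof -
    \<comment> \<open>Both root polynomials lie in one plane and have its least degree, so they are
      proportional. Being monic they are equal, and hence have the same roots.\<close>
    have "root_poly k t' \<in> wronskian_plane W (root_poly k t)"
      using eq self_in_wronskian_plane by simp
    moreover have "degree (root_poly k t') = degree (root_poly k t)" by (simp add: degree_root_poly)
    moreover have "\<exists>b. p = smult b (root_poly k t)"
      if "p \<in> wronskian_plane W (root_poly k t)" "degree p = degree (root_poly k t)" for p
      using _ _ _ W_lead _ _ _ that
      by (rule wronskian_plane_min_degree[where d = d])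
        (use t(1) k W_deg in \<open>auto simp: critical_iff degree_root_poly rsquarefree_root_poly\<close>)
    ultimately obtain b where b: "root_poly k t' = smult b (root_poly k t)" by blast
    then have "lead_coeff (root_poly k t') = b * lead_coeff (root_poly k t)" by (simp only: lead_coeff_smult)
    then have "b = 1" unfolding lead_coeff_root_poly by simp
    then have "root_poly k t' = root_poly k t" using b by simp
    then have "x \<in> t ` {1..k} \<longleftrightarrow> x \<in> t' ` {1..k}" for x
      unfolding poly_root_poly_eq_0_iff[symmetric] by (simp only:)
    then have "t ` {1..k} = t' ` {1..k}" by blast
    then show ?thesis using t by (intro perm_orbit_eqI) (auto simp: critical_iff)
  qed
  have surj: "\<exists>t\<in>?C. V = wronskian_plane W (root_poly k t)" if V: "V \<in> ?planes" for V
  proof -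
    have V': "nondegenerate_plane V" "plane_degree V = d" "plane_wronskian V = W" using V by auto
    obtain f where f: "lead_coeff f = 1" "rsquarefree f" "degree W = d + degree f - 1" "V = wronskian_plane W f"
      "\<forall>x. poly f x = 0 \<longrightarrow> poly W x \<noteq> 0 \<and>
         poly (W * pderiv (pderiv f) - pderiv W * pderiv f) x = 0"
      by (rule nondegenerate_plane_eq_wronskian_plane[OF V'(1), unfolded V'(2,3)]) (rule that)
    \<comment> \<open>Compares \<open>degree W = d + degree f - 1\<close> with
      \<open>M = d + k - 1\<close>.\<close>
    have "degree f = k" using f(3) W_deg k by linarith
    obtain t where "t \<in> extensional {1..degree f}" "inj_on t {1..degree f}" "f = root_poly (degree f) t"
      by (rule monic_rsquarefree_eq_root_poly[OF f(2,1)]) (rule that)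
    then have t: "t \<in> extensional {1..k}" "inj_on t {1..k}" "f = root_poly k t"
      unfolding \<open>degree f = k\<close> by this+
    have "t \<in> ?C" unfolding critical_iff using f(5) t(1,2) unfolding t(3) by (intro conjI)
    then show ?thesis using f(4) unfolding t(3) by blast
  qed
  have "bij_betw F (perm_orbit k ` ?C) ?planes"
    unfolding bij_betw_def
  proof
    show "inj_on F (perm_orbit k ` ?C)"
    proof (rule inj_onI, elim imageE)
      fix X Y t t' assume "F X = F Y" and XY: "X = perm_orbit k t" "Y = perm_orbit k t'"
        and t: "t \<in> ?C" "t' \<in> ?C"
      then have "wronskian_plane W (root_poly k t) = wronskian_plane W (root_poly k t')"
        by (simp only: F)
      then show "X = Y" unfolding XY by (rule inj[OF t])
    qed
    show "F ` perm_orbit k ` ?C = ?planes"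
    proof
      show "F ` perm_orbit k ` ?C \<subseteq> ?planes" using plane unfolding F[symmetric] by blast
      show "?planes \<subseteq> F ` perm_orbit k ` ?C" using surj unfolding F[symmetric] by blast
    qed
  qed
  moreover have "(\<Prod>i=1..k. [:- t i, 1:]) \<in> F (perm_orbit k t)" for t
    using self_in_wronskian_plane[of "root_poly k t"] by (simp add: F root_poly_def)
  ultimately show ?thesis by blast
qed

end
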